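(* Let $X$ be a finite set and let $f:\mathcal{I}\rightarrow\mathbb{R}$ be a polymatroid function defined on the uniform matroid $(X,\mathcal{I})$ of rank $k$, i.e. $\mathcal{I}=\{S\subseteq X: |S|\leq k\}$. Then $f$ can be extended to a polymatroid function $g$ defined on the uniform matroid of rank $k+1$ on $X$ (that is, there is a polymatroid function $g:\{S\subseteq X:|S|\leq k+1\}\rightarrow\mathbb{R}$ with $g(S)=f(S)$ for all $S\in\mathcal{I}$) if and only if for any $A\subseteq X$ with $|A|=k+1$, any $B\subset A$ with $|B|=k$, and any $a\in B$, $$f(B)-f(B\setminus\{a\})\geq f(B^* )-f(A\setminus\{a\}),$$ where $B^*\in\operatorname{argmax}_{C:\, C\subset A,\ |C|=k} f(C)$.
   Context: The uniform matroid of rank $K$ ($K\leq |X|$) on a finite set $X$ is $(X,\mathcal{I})$ with $\mathcal{I}=\{S\subseteq X:|S|\leq K\}$; here both ranks $k$ and $k+1$ are at most $|X|$. A function $h:\mathcal{J}\rightarrow\mathbb{R}$ on the collection $\mathcal{J}$ of independent sets of a matroid on $X$ is called a polymatroid function if $h(\emptyset)=0$, $h$ is monotone ($h(A)\leq h(B)$ for all $A\subseteq B$ with $A,B\in\mathcal{J}$), and $h$ is submodular ($h(A\cup\{j\})-h(A)\geq h(B\cup\{j\})-h(B)$ for all $A\subseteq B$ and $j\in X\setminus B$ with $B\cup\{j\}\in\mathcal{J}$). *)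

theory Defs
  imports Complex_Main
begin

locale matroid =
  fixes X :: "'a set" and J :: "'a set set"
  assumes finite_ground: "finite X"
    and indep_subset: "S \<in> J \<Longrightarrow> S \<subseteq> X"
    and indep_empty: "{} \<in> J"
    and indep_hereditary: "T \<in> J \<Longrightarrow> S \<subseteq> T \<Longrightarrow> S \<in> J"
    and indep_augment:
      "S \<in> J \<Longrightarrow> T \<in> J \<Longrightarrow> card S < card T \<Longrightarrow> \<exists>x \<in> T - S. insert x S \<in> J"

definition uniform_indep :: "'a set \<Rightarrow> nat \<Rightarrow> 'a set set" where
  "uniform_indep X K = {S. S \<subseteq> X \<and> card S \<le> K}"

lemma matroid_uniform_indep:
  assumes "finite X"
  shows "matroid X (uniform_indep X K)"
proof
  show "finite X" by fact
next
  fix S T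
  assume T: "T \<in> uniform_indep X K" and "S \<subseteq> T"
  then have "card S \<le> card T"
    using assms by (auto simp: uniform_indep_def intro: card_mono finite_subset)
  then show "S \<in> uniform_indep X K"
    using T \<open>S \<subseteq> T\<close> by (auto simp: uniform_indep_def)
next
  fix S T
  assume S: "S \<in> uniform_indep X K" and T: "T \<in> uniform_indep X K" and less: "card S < card T"
  have fin: "finite S" using S assms by (auto simp: uniform_indep_def intro: finite_subset)
  have "\<not> T \<subseteq> S" using card_mono[OF fin] less by (meson not_le)
  then obtain x where x: "x \<in> T" "x \<notin> S" by blast
  have "insert x S \<in> uniform_indep X K"
    using S T x less fin by (auto simp: uniform_indep_def)
  then show "\<exists>x \<in> T - S. insert x S \<in> uniform_indep X K" using x by blast
qed (auto simp: uniform_indep_def)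

text \<open>A function on the independent sets is represented by a total function on \<open>'a set\<close>;
  the axioms constrain only its values on \<open>J\<close>.\<close>

locale polymatroid_function = matroid X J
  for X :: "'a set" and J :: "'a set set" +
  fixes h :: "'a set \<Rightarrow> real"
  assumes empty_zero: "h {} = 0"
    and monotone: "A \<in> J \<Longrightarrow> B \<in> J \<Longrightarrow> A \<subseteq> B \<Longrightarrow> h A \<le> h B"
    and submodular:
      "A \<subseteq> B \<Longrightarrow> j \<in> X - B \<Longrightarrow> B \<union> {j} \<in> J \<Longrightarrow> h (A \<union> {j}) - h A \<ge> h (B \<union> {j}) - h B"

end

theory Submission
  imports Defs
begin

text \<open>An extension only has to choose a value \<open>g A\<close> for each \<open>A\<close> with \<open>k + 1\<close> elements.
  Monotonicity says that \<open>g A\<close> is at least the maximum of \<open>f\<close> on the \<open>k\<close>-subsets of \<open>A\<close>.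
  Since marginal gains of \<open>f\<close> decrease, submodularity only needs to be tested against the
  sets \<open>B - {a}\<close> with \<open>B \<subset> A\<close>, \<open>card B = k\<close>, where it is the upper bound
  \<open>g A \<le> f B + f (A - {a}) - f (B - {a})\<close>. The condition of the theorem is that the lower
  bound is below every upper bound, so the lower bound itself is an admissible value.\<close>

lemma is_arg_max_subsets_exists:
  fixes f :: "'a set \<Rightarrow> real"
  assumes "finite A" "k < card A"
  shows "\<exists>C. is_arg_max f (\<lambda>C. C \<subset> A \<and> card C = k) C"
proof -
  let ?S = "{C. C \<subset> A \<and> card C = k}"
  have fin: "finite ?S"
    by (rule finite_subset[of _ "Pow A"]) (use assms(1) in auto)
  obtain C where "C \<subseteq> A" "card C = k"
    using assms obtain_subset_with_card_n[of k A] by (metis less_imp_le)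
  \<comment> \<open>Since \<open>k < card A\<close>, a subset of \<open>A\<close> with
    \<open>k\<close> elements is automatically proper.\<close>
  then have "?S \<noteq> {}" using assms by auto
  then have "Max (f ` ?S) \<in> f ` ?S" using fin by (intro Max_in) auto
  then obtain M where "Max (f ` ?S) = f M" "M \<in> ?S" by (rule imageE)
  moreover have "f C \<le> Max (f ` ?S)" if "C \<in> ?S" for C
    using that fin by (intro Max_ge) auto
  ultimately have "is_arg_max f (\<lambda>C. C \<subset> A \<and> card C = k) M"
    by (simp add: is_arg_max_linorder)
  then show ?thesis ..
qed

text \<open>With \<open>j\<close> the only element of \<open>A - B\<close>, adding \<open>j\<close>
  takes \<open>B\<close> to \<open>A\<close> and \<open>B - {a}\<close> to \<open>A - {a}\<close>.
  Submodularity thus bounds \<open>g A\<close> from above, monotonicity bounds it from below by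
  \<open>g C\<close>, and eliminating \<open>g A\<close> leaves an inequality between values on
  smaller sets, where an extension agrees with \<open>f\<close>.\<close>

lemma uniform_extension_imp_condition:
  assumes g: "polymatroid_function X (uniform_indep X (k + 1)) g"
    and A: "A \<subseteq> X" "card A = k + 1"
    and B: "B \<subset> A" "card B = k" "a \<in> B"
    and C: "C \<subset> A"
  shows "g B - g (B - {a}) \<ge> g C - g (A - {a})"
proof -
  interpret polymatroid_function X "uniform_indep X (k + 1)" g by fact
  have finA: "finite A" using A finite_ground finite_subset by blast
  then have "finite B" using B(1) finite_subset by blast
  then have "card (A - B) = 1" using A B by (simp add: card_Diff_subset psubset_imp_subset)
  then obtain j where j: "A - B = {j}" by (auto simp: card_1_singleton_iff)
  have ins: "B \<union> {j} = A" "(B - {a}) \<union> {j} = A - {a}" "j \<in> X - B"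
    using j A B by auto
  have AJ: "A \<in> uniform_indep X (k + 1)" using A by (simp add: uniform_indep_def)
  have "g (A - {a}) - g (B - {a}) \<ge> g A - g B"
    using submodular[of "B - {a}" B j] ins AJ by auto
  moreover have "g C \<le> g A"
    using monotone[OF indep_hereditary AJ] AJ C by blast
  ultimately show ?thesis by simp
qed

text \<open>All maximizers share one value of \<open>f\<close>, so the value at a finite set with
  more than \<open>k\<close> elements does not depend on which one \<open>SOME\<close>
  picks.\<close>

definition max_extension :: "nat \<Rightarrow> ('a set \<Rightarrow> real) \<Rightarrow> 'a set \<Rightarrow> real" where
  "max_extension k f S =
    (if card S \<le> k then f S else f (SOME C. is_arg_max f (\<lambda>C. C \<subset> S \<and> card C = k) C))"

lemma max_extension_eq [simp]: "card S \<le> k \<Longrightarrow> max_extension k f S = f S"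
  by (simp add: max_extension_def)

lemma max_extension_arg_max:
  assumes "finite A" "k < card A"
  obtains C where "is_arg_max f (\<lambda>C. C \<subset> A \<and> card C = k) C" "max_extension k f A = f C"
proof (rule that)
  show "is_arg_max f (\<lambda>C. C \<subset> A \<and> card C = k)
      (SOME C. is_arg_max f (\<lambda>C. C \<subset> A \<and> card C = k) C)"
    using is_arg_max_subsets_exists[OF assms] by (rule someI_ex)
qed (use assms in \<open>simp add: max_extension_def\<close>)

lemma polymatroid_function_max_extension:
  fixes f :: "'a set \<Rightarrow> real"
  assumes f: "polymatroid_function X (uniform_indep X k) f"
    and cond: "\<And>A B a C. A \<subseteq> X \<Longrightarrow> card A = k + 1 \<Longrightarrow> B \<subset> A \<Longrightarrow> card B = k \<Longrightarrow> a \<in> B \<Longrightarrow>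
      is_arg_max f (\<lambda>C. C \<subset> A \<and> card C = k) C \<Longrightarrow> f B - f (B - {a}) \<ge> f C - f (A - {a})"
  shows "polymatroid_function X (uniform_indep X (k + 1)) (max_extension k f)"
proof -
  interpret polymatroid_function X "uniform_indep X k" f by fact
  let ?g = "max_extension k f"
  have fin: "finite S" if "S \<subseteq> X" for S using that finite_ground finite_subset by blast
  have le: "f A \<le> ?g B" if AB: "A \<subset> B" "B \<subseteq> X" "card B = k + 1" for A B
  proof -
    obtain M where M: "is_arg_max f (\<lambda>C. C \<subset> B \<and> card C = k) M" "?g B = f M"
      using max_extension_arg_max[of B k f] fin[OF AB(2)] AB(3) by auto
    \<comment> \<open>\<open>A\<close> may have fewer than \<open>k\<close> elements and so not
      compete in the maximum itself. Removing from \<open>B\<close> a point outside \<open>A\<close>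
      gives a \<open>k\<close>-set above \<open>A\<close> that does.\<close>
    obtain x where x: "x \<in> B" "x \<notin> A" using AB by blast
    then have C: "A \<subseteq> B - {x}" "B - {x} \<subset> B" "card (B - {x}) = k"
      using AB fin by auto
    then have "B - {x} \<in> uniform_indep X k" using AB by (auto simp: uniform_indep_def)
    then have "f A \<le> f (B - {x})" using monotone[OF indep_hereditary] C by blast
    also have "\<dots> \<le> f M" using M(1) C by (auto simp: is_arg_max_linorder)
    finally show ?thesis using M by simp
  qed
  show ?thesis
  proof (intro polymatroid_function.intro matroid_uniform_indep finite_ground
      polymatroid_function_axioms.intro)
    show "?g {} = 0" using empty_zero by simp
  next
    fix A B
    assume A: "A \<in> uniform_indep X (k + 1)" and B: "B \<in> uniform_indep X (k + 1)"
      and sub: "A \<subseteq> B"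
    show "?g A \<le> ?g B"
    proof (cases "card B \<le> k")
      case True
      then have BJ: "B \<in> uniform_indep X k" using B by (simp add: uniform_indep_def)
      then have "A \<in> uniform_indep X k" using sub indep_hereditary by blast
      then show ?thesis using monotone[OF _ BJ sub] BJ by (simp add: uniform_indep_def)
    next
      case False
      then have cB: "B \<subseteq> X" "card B = k + 1" using B by (auto simp: uniform_indep_def)
      show ?thesis
      proof (cases "A = B")
        case neq: False
        then have psub: "A \<subset> B" using sub by blast
        then have "card A \<le> k" using psubset_card_mono[OF fin[OF cB(1)] psub] cB(2) by simp
        then show ?thesis using le[OF psub] cB by simp
      qed simp
    qed
  next
    fix A B j
    assume AB: "A \<subseteq> B" and j: "j \<in> X - B" and BjJ: "B \<union> {j} \<in> uniform_indep X (k + 1)"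
    then have X: "B \<subseteq> X" "B \<union> {j} \<subseteq> X" by (auto simp: uniform_indep_def)
    have card_ins: "card (S \<union> {j}) = card S + 1" if "S \<subseteq> B" for S
    proof -
      have "j \<notin> S" "finite S" using that j X fin[of S] by auto
      then show ?thesis by simp
    qed
    have cB: "card B \<le> k" using BjJ card_ins[of B] by (simp add: uniform_indep_def)
    have cA: "card A \<le> card B" using AB fin X by (simp add: card_mono)
    show "?g (A \<union> {j}) - ?g A \<ge> ?g (B \<union> {j}) - ?g B"
    \<comment> \<open>If \<open>card B < k\<close>, all four sets have at most \<open>k\<close>
      elements and submodularity of \<open>f\<close> suffices. A new value enters only for
      \<open>card B = k\<close>, at \<open>B \<union> {j}\<close>.\<close>
    proof (cases "card B < k")
      case True
      then have "B \<union> {j} \<in> uniform_indep X k" using card_ins[of B] X by (simp add: uniform_indep_def)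
      moreover have "?g (A \<union> {j}) = f (A \<union> {j})" "?g (B \<union> {j}) = f (B \<union> {j})"
        using card_ins[of A] card_ins[of B] AB cA True by (auto intro!: max_extension_eq)
      moreover have "?g A = f A" "?g B = f B" using cA True by auto
      ultimately show ?thesis using submodular[OF AB j] by metis
    next
      case False
      then have cBk: "card B = k" using cB by simp
      show ?thesis
      proof (cases "A = B")
        case neq: False
        then obtain a where a: "a \<in> B" "a \<notin> A" using AB by blast
        \<comment> \<open>The comparison passes through \<open>?D\<close>, which lies between
          \<open>A\<close> and \<open>B\<close>. From \<open>A\<close> to \<open>?D\<close> the gain
          of \<open>j\<close> decreases by submodularity of \<open>f\<close>, as
          \<open>?D \<union> {j}\<close> has exactly \<open>k\<close> elements. From
          \<open>?D\<close> to \<open>B\<close> it decreases by \<open>cond\<close> for the set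
          \<open>B \<union> {j}\<close>, because removing \<open>a\<close> from that set gives
          \<open>?D \<union> {j}\<close>.\<close>
        let ?D = "B - {a}"
        have D: "?D \<subseteq> B" "A \<subseteq> ?D" "j \<in> X - ?D" using a AB j by auto
        have swap: "?D \<union> {j} = (B \<union> {j}) - {a}" using a j by auto
        have cD: "card ?D + 1 = k" using a cBk fin[OF X(1)] by (metis Suc_eq_plus1 card_Suc_Diff1)
        then have DJ: "?D \<union> {j} \<in> uniform_indep X k"
          using card_ins[OF D(1)] X by (auto simp: uniform_indep_def)
        have cA': "card A < k"
          using cD card_mono[OF _ D(2)] fin[OF X(1)] by simp
        have psub: "B \<subset> B \<union> {j}" using j by blast
        obtain M where M: "is_arg_max f (\<lambda>C. C \<subset> B \<union> {j} \<and> card C = k) M"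
          "?g (B \<union> {j}) = f M"
          using max_extension_arg_max[of "B \<union> {j}" k f] fin[OF X(2)] card_ins[of B] cBk
          by (metis less_add_one subset_refl)
        have "f M - f (?D \<union> {j}) \<le> f B - f ?D"
          using cond[OF X(2) _ psub cBk a(1) M(1)] card_ins[of B] cBk swap by simp
        moreover have "f (A \<union> {j}) - f A \<ge> f (?D \<union> {j}) - f ?D"
          using submodular[OF D(2,3) DJ] .
        moreover have "?g (A \<union> {j}) = f (A \<union> {j})" "?g A = f A" "?g B = f B"
          using card_ins[OF AB] cA' cBk by (auto intro!: max_extension_eq)
        ultimately show ?thesis using M(2) by linarith
      qed simp
    qed
  qed
qed

theorem theorem3:
  fixes X :: "'a set" and k :: nat and f :: "'a set \<Rightarrow> real"
  assumes "finite X"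
    and "k + 1 \<le> card X"
    and "polymatroid_function X (uniform_indep X k) f"
  shows "(\<exists>g. polymatroid_function X (uniform_indep X (k + 1)) g \<and>
              (\<forall>S \<in> uniform_indep X k. g S = f S)) \<longleftrightarrow>
    (\<forall>A B a Bstar. A \<subseteq> X \<longrightarrow> card A = k + 1 \<longrightarrow> B \<subset> A \<longrightarrow> card B = k \<longrightarrow> a \<in> B \<longrightarrow>
       is_arg_max f (\<lambda>C. C \<subset> A \<and> card C = k) Bstar \<longrightarrow>
       f B - f (B - {a}) \<ge> f Bstar - f (A - {a}))"
    (is "?ext \<longleftrightarrow> ?cond")
proof
  assume ?ext
  then obtain g where g: "polymatroid_function X (uniform_indep X (k + 1)) g"
    and eq: "\<And>S. S \<subseteq> X \<Longrightarrow> card S \<le> k \<Longrightarrow> g S = f S"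
    by (auto simp: uniform_indep_def)
  show ?cond
  proof (intro allI impI)
    fix A B a Bstar
    assume A: "A \<subseteq> X" "card A = k + 1" and B: "B \<subset> A" "card B = k" "a \<in> B"
      and "is_arg_max f (\<lambda>C. C \<subset> A \<and> card C = k) Bstar"
    then have C: "Bstar \<subset> A" "card Bstar = k" by (auto simp: is_arg_max_def)
    have "finite A" using A(1) assms(1) finite_subset by blast
    \<comment> \<open>All four sets in the condition have at most \<open>k\<close> elements, so
      \<open>g\<close> can be replaced by \<open>f\<close> on each of them.\<close>
    then have "card (A - {a}) \<le> k" using A B by auto
    moreover have "card (B - {a}) \<le> k" using B card_Diff1_le[of B a] by simp
    moreover have "B \<subseteq> X" "B - {a} \<subseteq> X" "A - {a} \<subseteq> X" "Bstar \<subseteq> X" using A B C by auto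
    ultimately have "g B = f B" "g (B - {a}) = f (B - {a})" "g (A - {a}) = f (A - {a})"
      "g Bstar = f Bstar"
      using B C by (auto intro!: eq)
    then show "f B - f (B - {a}) \<ge> f Bstar - f (A - {a})"
      using uniform_extension_imp_condition[OF g A B C(1)] by simp
  qed
next
  assume ?cond
  then have "polymatroid_function X (uniform_indep X (k + 1)) (max_extension k f)"
    by (intro polymatroid_function_max_extension[OF assms(3)]) blast
  then show ?ext
    by (intro exI[of _ "max_extension k f"]) (auto simp: uniform_indep_def)
qed

end
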